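(* Let $u,n$ be positive integers, $p_{\mathsf{fail}}\ge0$, $\varepsilon^{-}\ge 0$, and let $F$ be an N-static filter in $F_{\mathsf{static}}(u,n,p_{\mathsf{fail}},\varepsilon^{-})$. Then for every real $\alpha>1$, \[ 2^{\mathrm{space}(F)}\cdot\sum_{0\le k\le \alpha n\varepsilon^{-}}\binom{u}{k}\ \ge\ \Big(1-\frac1\alpha-p_{\mathsf{fail}}\Big)\binom{u}{n}. \]
   Context: Universe $[u]=\{0,\dots,u-1\}$. A static filter is a pair of algorithms $A_{\mathsf{init}},A_{\mathsf{query}}$ sharing a random string $r$ drawn from a distribution over strings of bounded length. On a dataset $S\subseteq[u]$, $A_{\mathsf{init}}(r,S)$ returns the state $M(r,S)$, a binary string or the symbol $\mathsf{fail}$; a query for $x\in[u]$ returns the bit $A_{\mathsf{query}}(r,M(r,S),x)$ (queries do not change the state). $F\in F_{\mathsf{static}}(u,n,p_{\mathsf{fail}},\varepsilon^{-})$ (an N-static filter) means: for every $S\subseteq[u]$ with $|S|\le n$ and every $x\in[u]$: $\Pr_r[M(r,S)=\mathsf{fail}]\le p_{\mathsf{fail}}$; if $x\in S$ then $\Pr_r[A_{\mathsf{query}}(r,M(r,S),x)=0\mid M(r,S)\ne\mathsf{fail}]\le\varepsilon^{-}$; if $x\notin S$ or $M(r,S)=\mathsf{fail}$, the answer is $0$ (no false positives). $\mathrm{space}(F)=\max_{S\subseteq[u],|S|=n}\max_r|M(r,S)|$ in bits (the random string is not counted).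
   Formalization: Added assumption: for each fixed random string r, no non-fail state of a size-n dataset is a proper prefix of another (e.g. all states have equal length). With arbitrary variable-length states the claim fails: u=3, n=1, zero errors, states "", "1", "0", α=4 gives 2 < 9/4. *)

theory Defs
  imports "HOL-Probability.Probability" "HOL-Library.Sublist"
begin

text \<open>
  The two algorithms are arbitrary functions; no bound on their running time and no computability is
  required. The state \<open>None\<close> is the symbol \<open>fail\<close>, and the answer bits \<open>1\<close> and \<open>0\<close> are
  \<open>True\<close> and \<open>False\<close>.
\<close>

record filter_alg =
  rand :: "bool list pmf"
  init :: "bool list \<Rightarrow> nat set \<Rightarrow> bool list option"
  query :: "bool list \<Rightarrow> bool list option \<Rightarrow> nat \<Rightarrow> bool"

definition static_filter :: "nat \<Rightarrow> nat \<Rightarrow> real \<Rightarrow> real \<Rightarrow> filter_alg \<Rightarrow> bool" where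
  "static_filter u n p_fail eps F \<longleftrightarrow>
     (\<exists>L. \<forall>r\<in>set_pmf (rand F). length r \<le> L) \<and>
     (\<forall>S x. S \<subseteq> {..<u} \<longrightarrow> card S \<le> n \<longrightarrow> x \<in> {..<u} \<longrightarrow>
        \<P>(r in measure_pmf (rand F). init F r S = None) \<le> p_fail \<and>
        (x \<in> S \<longrightarrow>
          \<P>(r in measure_pmf (rand F). \<not> query F r (init F r S) x \<bar> init F r S \<noteq> None) \<le> eps) \<and>
        (\<forall>r\<in>set_pmf (rand F).
          x \<notin> S \<or> init F r S = None \<longrightarrow> \<not> query F r (init F r S) x))"

text \<open>
  The symbol \<open>fail\<close> counts as length \<open>0\<close>. The supremum below is taken over a finite set of
  natural numbers whenever the random strings have bounded length; it is then the maximum, and \<open>0\<close>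
  if there is no dataset of size \<open>n\<close>.
\<close>

definition state_length :: "bool list option \<Rightarrow> nat" where
  "state_length m = (case m of None \<Rightarrow> 0 | Some w \<Rightarrow> length w)"

definition filter_space :: "nat \<Rightarrow> nat \<Rightarrow> filter_alg \<Rightarrow> nat" where
  "filter_space u n F =
     (SUP (S, r)\<in>{S. S \<subseteq> {..<u} \<and> card S = n} \<times> set_pmf (rand F). state_length (init F r S))"

text \<open>
  There are \<open>2 ^ (s + 1) - 1\<close> strings of length at most \<open>s\<close>, so \<open>s\<close> bits of space
  bound the number of states by \<open>2 ^ s\<close> only if the length of a state carries no information:
  all states have the same length (a memory of \<open>s\<close> bits) or, more generally, for each random
  string no state is a proper prefix of another one. Without such a convention the lower bound
  fails, see \<open>space_bound_needs_self_delimiting\<close> below.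
\<close>

definition self_delimiting :: "nat \<Rightarrow> nat \<Rightarrow> filter_alg \<Rightarrow> bool" where
  "self_delimiting u n F \<longleftrightarrow>
     (\<forall>r\<in>set_pmf (rand F). \<forall>S T v w.
        S \<subseteq> {..<u} \<longrightarrow> card S = n \<longrightarrow> T \<subseteq> {..<u} \<longrightarrow> card T = n \<longrightarrow>
        init F r S = Some v \<longrightarrow> init F r T = Some w \<longrightarrow> prefix v w \<longrightarrow> v = w)"

lemma self_delimiting_if_fixed_length:
  assumes "\<And>r S w. r \<in> set_pmf (rand F) \<Longrightarrow> S \<subseteq> {..<u} \<Longrightarrow> card S = n \<Longrightarrow>
             init F r S = Some w \<Longrightarrow> length w = s"
  shows "self_delimiting u n F"
  unfolding self_delimiting_def
proof (intro ballI allI impI)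
  fix r S T v w
  assume "r \<in> set_pmf (rand F)" "S \<subseteq> {..<u}" "card S = n" "T \<subseteq> {..<u}" "card T = n"
    "init F r S = Some v" "init F r T = Some w" and vw: "prefix v w"
  then have "length v = length w"
    using assms by simp
  with vw show "v = w"
    by (auto simp: prefix_def)
qed

lemma space_bound_needs_self_delimiting:
  "\<exists>F. static_filter 3 1 0 0 F \<and>
       \<not> (1 - 1 / 4 - 0) * real (3 choose 1)
            \<le> 2 ^ filter_space 3 1 F * (\<Sum>k | real k \<le> 4 * real 1 * 0. real (3 choose k))"
proof -
  define e :: "nat set \<Rightarrow> bool list" where
    "e S = (if S = {0} then [] else if S = {1} then [True] else if S = {2} then [False]
            else [True, True])" for S
  define q :: "bool list option \<Rightarrow> nat \<Rightarrow> bool" where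
    "q m x \<longleftrightarrow> m = Some [] \<and> x = 0 \<or> m = Some [True] \<and> x = 1 \<or> m = Some [False] \<and> x = 2" for m x
  define F where "F = \<lparr>rand = return_pmf [], init = (\<lambda>r S. Some (e S)), query = (\<lambda>r. q)\<rparr>"
  have singletons: "S \<in> {{}, {0}, {1}, {2}}" if S: "S \<subseteq> {..<3}" "card S \<le> 1" for S :: "nat set"
  proof -
    have "finite S"
      using S(1) by (rule finite_subset) simp
    then consider "S = {}" | a where "S = {a}"
      using S(2) by (metis card_1_singletonE card_0_eq le_Suc_eq le_zero_eq One_nat_def)
    then show ?thesis
    proof cases
      case 2
      with S(1) have "a = 0 \<or> a = 1 \<or> a = 2"
        by auto
      with 2 show ?thesis
        by blast
    qed simp
  qed
  have exact: "q (Some (e S)) x \<longleftrightarrow> x \<in> S" if "S \<subseteq> {..<3}" "card S \<le> 1" for S x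
    using singletons[OF that] by (auto simp: e_def q_def)
  have "static_filter 3 1 0 0 F"
    unfolding static_filter_def F_def by (auto simp: exact cond_prob_def)
  moreover have "filter_space 3 1 F \<le> 1"
    unfolding filter_space_def
  proof (rule cSUP_least)
    show "{S :: nat set. S \<subseteq> {..<3} \<and> card S = 1} \<times> set_pmf (rand F) \<noteq> {}"
      by (auto simp: F_def intro!: exI[of _ "{0::nat}"])
    show "(case p of (S, r) \<Rightarrow> state_length (init F r S)) \<le> 1"
      if p: "p \<in> {S :: nat set. S \<subseteq> {..<3} \<and> card S = 1} \<times> set_pmf (rand F)" for p
    proof -
      obtain S r where Sr: "p = (S, r)" "S \<subseteq> {..<3}" "card S = 1"
        using p by auto
      then have "S = {0} \<or> S = {1} \<or> S = {2}"
        using singletons[of S] by auto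
      then have "length (e S) \<le> 1"
        by (elim disjE) (simp_all add: e_def)
      then show ?thesis
        by (simp add: Sr(1) F_def state_length_def)
    qed
  qed
  then have "(2 :: real) ^ filter_space 3 1 F \<le> 2 ^ 1"
    by (intro power_increasing) auto
  moreover have "{k. real k \<le> 4 * real 1 * 0} = {0}"
    by auto
  ultimately show ?thesis
    by (intro exI[of _ F]) simp
qed

end

theory Submission
  imports Defs
begin

text \<open>
  By Markov's inequality a dataset of size \<open>n\<close> is, with probability at least
  \<open>1 - 1 / \<alpha> - p_fail\<close>, stored without failure and with at most \<open>\<alpha> n eps\<close> false negatives. By
  averaging, some random string \<open>r\<close> works for that fraction of the datasets. Given \<open>r\<close>, such a
  dataset is determined by its state together with the set of its false negatives, because there
  are no false positives. The possible states form a prefix-free code with words of length at most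
  the space.
\<close>

text \<open>Padding all words to length \<open>s\<close> is injective on a prefix-free set: two
  words with the same padding are both prefixes of it, hence comparable, hence equal.\<close>

lemma card_prefix_free_le:
  fixes W :: "bool list set"
  assumes free: "\<And>v w. v \<in> W \<Longrightarrow> w \<in> W \<Longrightarrow> prefix v w \<Longrightarrow> v = w"
    and len: "\<And>w. w \<in> W \<Longrightarrow> length w \<le> s"
  shows "card W \<le> 2 ^ s"
proof -
  define pad where "pad w = w @ replicate (s - length w) False" for w
  let ?L = "{w :: bool list. set w \<subseteq> UNIV \<and> length w = s}"
  have "inj_on pad W"
  proof (rule inj_onI)
    fix v w assume vw: "v \<in> W" "w \<in> W" "pad v = pad w"
    have "prefix v (pad v)" "prefix w (pad w)"
      by (simp_all add: pad_def)
    with vw(3) have "prefix v (pad w)" "prefix w (pad w)"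
      by simp_all
    then have "prefix v w \<or> prefix w v"
      by (rule prefix_same_cases)
    with vw free show "v = w"
      by blast
  qed
  moreover have "pad ` W \<subseteq> ?L"
    using len by (auto simp: pad_def)
  moreover have "finite ?L"
    by (rule finite_lists_length_eq) simp
  ultimately have "card W \<le> card ?L"
    by (rule card_inj_on_le)
  also have "\<dots> = 2 ^ s"
    by (subst card_lists_length_eq) simp_all
  finally show ?thesis .
qed

text \<open>Markov's inequality for the number of events that occur, whose expectation is by
  linearity at most \<open>card I * e\<close>. The strict inequality inside the event keeps the
  bound true when this product is 0.\<close>

lemma (in prob_space) prob_many_events_le:
  fixes e a :: real
  assumes "finite I" and ev: "\<And>i. i \<in> I \<Longrightarrow> A i \<in> events"
    and le: "\<And>i. i \<in> I \<Longrightarrow> prob (A i) \<le> e" and e: "e \<ge> 0" and a: "a > 0"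
  shows "\<P>(x in M. a * real (card I) * e < real (card {i \<in> I. x \<in> A i})) \<le> 1 / a"
proof -
  have card_eq: "real (card {i \<in> I. x \<in> A i}) = (\<Sum>i\<in>I. indicator (A i) x)" for x
    using \<open>finite I\<close> by (simp add: indicator_def sum.If_cases Int_def)
  have int: "integrable M (\<lambda>x. \<Sum>i\<in>I. indicat_real (A i) x)"
    using ev by (intro Bochner_Integration.integrable_sum integrable_real_indicator)
      (auto simp: emeasure_eq_measure)
  have "(\<integral>x. (\<Sum>i\<in>I. indicat_real (A i) x) \<partial>M) = (\<Sum>i\<in>I. prob (A i))"
    using ev by (subst Bochner_Integration.integral_sum) (auto simp: emeasure_eq_measure)
  also have "\<dots> \<le> real (card I) * e"
    using le by (rule sum_bounded_above)
  finally have expect: "(\<integral>x. (\<Sum>i\<in>I. indicat_real (A i) x) \<partial>M) \<le> real (card I) * e" .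
  have markov: "\<P>(x in M. t \<le> (\<Sum>i\<in>I. indicat_real (A i) x)) \<le> real (card I) * e / t"
    if "t > 0" for t
  proof -
    have "\<P>(x in M. t \<le> (\<Sum>i\<in>I. indicat_real (A i) x))
        \<le> (\<integral>x. (\<Sum>i\<in>I. indicat_real (A i) x) \<partial>M) / t"
      using int that by (intro integral_Markov_inequality_measure[where A = "space M"])
        (auto intro!: AE_I2 sum_nonneg)
    also have "\<dots> \<le> real (card I) * e / t"
      using expect that by (intro divide_right_mono) auto
    finally show ?thesis .
  qed
  \<comment> \<open>Markov needs a positive threshold. If \<open>card I * e\<close> is 0, the
    threshold 1 serves: a count above 0 is at least 1, and the resulting bound is 0.\<close>
  define t where "t = (if real (card I) * e = 0 then 1 else a * real (card I) * e)"
  have t: "t > 0"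
    using e a by (auto simp: t_def zero_less_mult_iff)
  have meas: "(\<lambda>x. \<Sum>i\<in>I. indicat_real (A i) x) \<in> borel_measurable M"
    using int by simp
  have imp: "t \<le> real (card {i \<in> I. x \<in> A i})"
    if "a * real (card I) * e < real (card {i \<in> I. x \<in> A i})" for x
    using that by (auto simp: t_def)
  have "\<P>(x in M. a * real (card I) * e < real (card {i \<in> I. x \<in> A i}))
      \<le> \<P>(x in M. t \<le> (\<Sum>i\<in>I. indicat_real (A i) x))"
    using meas imp unfolding card_eq by (intro finite_measure_mono) auto
  also have "\<dots> \<le> real (card I) * e / t"
    using t by (rule markov)
  also have "\<dots> \<le> 1 / a"
    using a by (auto simp: t_def)
  finally show ?thesis .
qed

lemma (in prob_space) joint_prob_le_if_cond_prob_le: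
  assumes "\<P>(x in M. P x \<bar> Q x) \<le> e" and "e \<ge> 0"
    and "{x \<in> space M. P x \<and> Q x} \<in> events" "{x \<in> space M. Q x} \<in> events"
  shows "\<P>(x in M. P x \<and> Q x) \<le> e"
\<comment> \<open>A conditional probability given a null event is 0 by the convention for division,
  so the assumption on it then yields no bound; the joint event is null as part of the null
  event.\<close>
proof (cases "\<P>(x in M. Q x) = 0")
  case True
  have "\<P>(x in M. P x \<and> Q x) \<le> \<P>(x in M. Q x)"
    using assms by (intro finite_measure_mono) auto
  with True \<open>e \<ge> 0\<close> show ?thesis
    by simp
next
  case False
  then have "\<P>(x in M. Q x) > 0"
    by (simp add: zero_less_measure_iff)
  then have "\<P>(x in M. P x \<and> Q x) \<le> e * \<P>(x in M. Q x)"
    using assms(1) by (simp add: cond_prob_def pos_divide_le_eq)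
  also have "\<dots> \<le> e * 1"
    using \<open>e \<ge> 0\<close> by (intro mult_left_mono) auto
  finally show ?thesis
    by simp
qed

text \<open>Averaging: the expected number of successful \<open>S\<close> is the sum of their
  success probabilities, at least \<open>c * card D\<close>, so not every outcome can stay strictly
  below this value.\<close>

lemma exists_outcome_with_many_successes:
  fixes R :: "'a pmf" and c :: real
  assumes "finite (set_pmf R)" and "finite D"
    and "\<And>S. S \<in> D \<Longrightarrow> c \<le> \<P>(r in measure_pmf R. P r S)"
  shows "\<exists>r\<in>set_pmf R. c * real (card D) \<le> real (card {S \<in> D. P r S})"
proof (rule ccontr)
  assume "\<not> ?thesis"
  then have less: "real (card {S \<in> D. P r S}) < c * real (card D)" if "r \<in> set_pmf R" for r
    using that by (simp add: not_le)
  have card_eq: "real (card {S \<in> D. P r S}) = (\<Sum>S\<in>D. indicator {r. P r S} r)" for r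
    using \<open>finite D\<close> by (simp add: indicator_def sum.If_cases Int_def)
  have int: "integrable (measure_pmf R) f" for f :: "'a \<Rightarrow> real"
    using assms(1) by (rule integrable_measure_pmf_finite)
  have "c * real (card D) \<le> (\<Sum>S\<in>D. \<P>(r in measure_pmf R. P r S))"
    using sum_bounded_below[of D c] assms(3) by (simp add: mult.commute)
  also have "\<dots> = measure_pmf.expectation R (\<lambda>r. real (card {S \<in> D. P r S}))"
    unfolding card_eq by (subst Bochner_Integration.integral_sum) (auto intro: int)
  also have "\<dots> < c * real (card D)"
    using int less by (intro measure_pmf.expectation_less) (auto simp: AE_measure_pmf_iff)
  finally show False
    by simp
qed

text \<open>Union bound: an outcome that is not good either fails, which costs
  \<open>p_fail\<close>, or has too many misses, which costs 1 / \<alpha> by Markov.\<close>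

lemma prob_stored_with_few_misses:
  assumes filter: "static_filter u n p_fail eps F" and "eps \<ge> 0" "\<alpha> > 0"
    and S: "S \<subseteq> {..<u}" "card S = n" "n > 0"
  shows "1 - 1 / \<alpha> - p_fail \<le> \<P>(r in measure_pmf (rand F). init F r S \<noteq> None \<and>
           real (card {x \<in> S. \<not> query F r (init F r S) x}) \<le> \<alpha> * real n * eps)"
    (is "_ \<le> measure_pmf.prob ?R {r \<in> _. ?good r}")
proof -
  \<comment> \<open>Non-failure is part of the event because a failed state answers 0 to every
    query: without it the probability could exceed \<open>eps\<close>, while the joint probability
    is bounded by the conditional one.\<close>
  define miss where
    "miss x = {r. \<not> query F r (init F r S) x \<and> init F r S \<noteq> None}" for x
  define many where "many = {r. \<alpha> * real n * eps < real (card {x \<in> S. r \<in> miss x})}"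
  have "finite S"
    using S by (intro card_ge_0_finite) simp
  have miss: "measure_pmf.prob ?R (miss x) \<le> eps" if "x \<in> S" for x
    using filter measure_pmf.joint_prob_le_if_cond_prob_le[of ?R
        "\<lambda>r. \<not> query F r (init F r S) x" "\<lambda>r. init F r S \<noteq> None" eps] S that \<open>eps \<ge> 0\<close>
    unfolding static_filter_def miss_def by auto
  have "measure_pmf.prob ?R many \<le> 1 / \<alpha>"
    using measure_pmf.prob_many_events_le[of S miss ?R eps \<alpha>] \<open>finite S\<close> miss assms(2,3) S
    by (simp add: many_def)
  moreover have "measure_pmf.prob ?R {r. init F r S = None} \<le> p_fail"
  proof -
    \<comment> \<open>The failure bound in \<open>static_filter\<close> stands under a quantifier
      over a queried element, so one must be supplied; \<open>n > 0\<close> provides it.\<close>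
    obtain x where "x \<in> S"
      using S by fastforce
    then show ?thesis
      using filter S unfolding static_filter_def by auto
  qed
  moreover have "1 = measure_pmf.prob ?R UNIV"
    by simp
  moreover have "\<dots> \<le> measure_pmf.prob ?R ({r. ?good r} \<union> (many \<union> {r. init F r S = None}))"
    by (intro measure_pmf.finite_measure_mono) (auto simp: many_def miss_def not_le)
  moreover have "\<dots> \<le> measure_pmf.prob ?R {r. ?good r} +
      (measure_pmf.prob ?R many + measure_pmf.prob ?R {r. init F r S = None})"
    by (intro order.trans[OF measure_Un_le] add_left_mono measure_Un_le) auto
  ultimately show ?thesis
    by simp
qed

lemma finite_real_of_nat_le: "finite {k :: nat. real k \<le> c}"
  by (rule finite_subset[of _ "{..nat \<lfloor>c\<rfloor>}"]) (auto simp: le_nat_floor)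

lemma card_small_subsets:
  "card {T. T \<subseteq> {..<u :: nat} \<and> real (card T) \<le> c} = (\<Sum>k | real k \<le> c. u choose k)"
proof -
  have "{T. T \<subseteq> {..<u} \<and> real (card T) \<le> c}
      = (\<Union>k\<in>{k. real k \<le> c}. {T. T \<subseteq> {..<u} \<and> card T = k})"
    by auto
  also have "card \<dots> = (\<Sum>k | real k \<le> c. card {T. T \<subseteq> {..<u} \<and> card T = k})"
    by (intro card_UN_disjoint) (auto simp: finite_real_of_nat_le)
  also have "\<dots> = (\<Sum>k | real k \<le> c. u choose k)"
    by (simp add: n_subsets)
  finally show ?thesis .
qed

text \<open>Finiteness gives integrability in the averaging argument and makes the supremum in
  \<open>filter_space\<close> a genuine upper bound.\<close>

lemma finite_rand_static_filter:
  assumes "static_filter u n p_fail eps F"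
  shows "finite (set_pmf (rand F))"
proof -
  obtain L where "\<forall>r\<in>set_pmf (rand F). length r \<le> L"
    using assms by (auto simp: static_filter_def)
  then show ?thesis
    by (intro finite_subset[OF _ finite_lists_length_le[of "UNIV :: bool set" L]]) auto
qed

lemma state_length_le_filter_space:
  assumes "finite (set_pmf (rand F))" "r \<in> set_pmf (rand F)" "S \<subseteq> {..<u}" "card S = n"
  shows "state_length (init F r S) \<le> filter_space u n F"
proof -
  let ?D = "{S. S \<subseteq> {..<u} \<and> card S = n} \<times> set_pmf (rand F)"
  have "finite ?D"
    using assms(1) by auto
  then have "(case (S, r) of (S, r) \<Rightarrow> state_length (init F r S)) \<le> filter_space u n F"
    unfolding filter_space_def using assms
    by (intro cSUP_upper bdd_above_finite finite_imageI) auto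
  then show ?thesis
    by simp
qed

text \<open>For fixed \<open>r\<close>, the state and the set of false negatives encode a good
  dataset injectively. The states are counted as a prefix-free code, the false negatives as small
  subsets of the universe.\<close>

lemma card_stored_with_few_misses_le:
  assumes filter: "static_filter u n p_fail eps F" and delim: "self_delimiting u n F"
    and r: "r \<in> set_pmf (rand F)"
  shows "card {S. (S \<subseteq> {..<u} \<and> card S = n) \<and> init F r S \<noteq> None \<and>
            real (card {x \<in> S. \<not> query F r (init F r S) x}) \<le> c}
         \<le> 2 ^ filter_space u n F * (\<Sum>k | real k \<le> c. u choose k)"
    (is "card ?G \<le> _")
proof -
  define W where "W = {w. \<exists>S\<subseteq>{..<u}. card S = n \<and> init F r S = Some w}"
  define code where "code S = (the (init F r S), {x \<in> S. \<not> query F r (init F r S) x})" for S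
  let ?T = "{T. T \<subseteq> {..<u} \<and> real (card T) \<le> c}"
  have no_false_pos: "x \<in> S"
    if "query F r (init F r S) x" "S \<subseteq> {..<u}" "card S = n" "x < u" for S x
    using filter that r unfolding static_filter_def by auto
  \<comment> \<open>The right-hand side depends on \<open>S\<close> only through
    \<open>code S\<close>: the positive answers lie in \<open>S\<close> and miss exactly the
    recorded false negatives. Since \<open>S\<close> did not fail,
    \<open>Some (fst (code S))\<close> is its actual state.\<close>
  have decode: "S = snd (code S) \<union> {x. x < u \<and> query F r (Some (fst (code S))) x}"
    if "S \<in> ?G" for S
    using that no_false_pos[of S] by (auto simp: code_def)
  have "inj_on code ?G"
  proof (rule inj_onI)
    fix S T assume ST: "S \<in> ?G" "T \<in> ?G" "code S = code T"
    show "S = T"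
      using decode[OF ST(1)] decode[OF ST(2)] unfolding ST(3) by (rule trans[OF _ sym])
  qed
  moreover have "code ` ?G \<subseteq> W \<times> ?T"
    by (auto simp: code_def W_def)
  moreover have "W \<subseteq> (\<lambda>S. the (init F r S)) ` Pow {..<u}"
  proof
    fix w assume "w \<in> W"
    then obtain S where "S \<subseteq> {..<u}" "init F r S = Some w"
      unfolding W_def by blast
    then show "w \<in> (\<lambda>S. the (init F r S)) ` Pow {..<u}"
      by (intro image_eqI[of _ _ S]) auto
  qed
  then have "finite W"
    by (rule finite_subset) simp
  then have "finite (W \<times> ?T)"
    by simp
  ultimately have "card ?G \<le> card (W \<times> ?T)"
    by (rule card_inj_on_le)
  also have "\<dots> = card W * (\<Sum>k | real k \<le> c. u choose k)"
    by (simp add: card_cartesian_product card_small_subsets)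
  also have "card W \<le> 2 ^ filter_space u n F"
  proof (rule card_prefix_free_le)
    fix v w assume "v \<in> W" "w \<in> W" "prefix v w"
    then obtain S T where "S \<subseteq> {..<u}" "card S = n" "init F r S = Some v"
        "T \<subseteq> {..<u}" "card T = n" "init F r T = Some w"
      unfolding W_def by blast
    with \<open>prefix v w\<close> delim r show "v = w"
      unfolding self_delimiting_def by blast
  next
    fix w assume "w \<in> W"
    then obtain S where S: "S \<subseteq> {..<u}" "card S = n" and w: "init F r S = Some w"
      unfolding W_def by blast
    show "length w \<le> filter_space u n F"
      using state_length_le_filter_space[OF finite_rand_static_filter[OF filter] r S]
      by (simp add: w state_length_def)
  qed
  finally show ?thesis
    by simp
qed

theorem theorem10:
  fixes u n :: nat and p_fail eps \<alpha> :: real and F :: filter_alg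
  assumes "u > 0" and "n > 0" and "p_fail \<ge> 0" and "eps \<ge> 0"
    and "static_filter u n p_fail eps F"
    and "self_delimiting u n F"
    and "\<alpha> > 1"
  shows "2 ^ filter_space u n F * (\<Sum>k | real k \<le> \<alpha> * real n * eps. real (u choose k))
           \<ge> (1 - 1 / \<alpha> - p_fail) * real (u choose n)"
proof -
  let ?D = "{S. S \<subseteq> {..<u} \<and> card S = n}"
  let ?good = "\<lambda>r S. init F r S \<noteq> None \<and>
    real (card {x \<in> S. \<not> query F r (init F r S) x}) \<le> \<alpha> * real n * eps"
  have "1 - 1 / \<alpha> - p_fail \<le> \<P>(r in measure_pmf (rand F). ?good r S)" if "S \<in> ?D" for S
    using that assms by (intro prob_stored_with_few_misses) auto
  \<comment> \<open>A single \<open>r\<close> is fixed for all datasets, since decoding and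
    prefix-freeness are available only among states with the same random string.\<close>
  then obtain r where r: "r \<in> set_pmf (rand F)"
    and many: "(1 - 1 / \<alpha> - p_fail) * real (card ?D) \<le> real (card {S \<in> ?D. ?good r S})"
    using exists_outcome_with_many_successes[of "rand F" ?D _ ?good]
      finite_rand_static_filter[OF assms(5)] by auto
  have "(1 - 1 / \<alpha> - p_fail) * real (u choose n) \<le> real (card {S \<in> ?D. ?good r S})"
    using many by (simp add: n_subsets)
  also have "\<dots> \<le> real (2 ^ filter_space u n F *
      (\<Sum>k | real k \<le> \<alpha> * real n * eps. u choose k))"
    unfolding of_nat_le_iff mem_Collect_eq using assms(5,6) r
    by (rule card_stored_with_few_misses_le)
  finally show ?thesis
    by simp
qed

end
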